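(* Let $X$ be a finite-dimensional real Hilbert space, let $w\in X$, and let $U$ and $V$ be nonempty polyhedral subsets of $X$. Let $r>0$, set $f=\tfrac r2\|\cdot-w\|^2+\iota_U$ and $g=\iota_V$. Let $T=\tfrac12(\mathrm{Id}+R_gR_f)$, let $\mathsf v=P_{\overline{\operatorname{ran}}(\mathrm{Id}-T)}(0)$, and let $Z=\{x\in X:0\in-\mathsf v+\partial f(x)+\partial g(x-\mathsf v)\}$. Let $x\in X$. Then there exists $\overline{x}\in X$ such that the following hold: (i) $f$ is strongly convex. (ii) $\overline{\operatorname{ran}}(\mathrm{Id}-T)=U-V$. (iii) $\mathsf v\in U-V=\operatorname{dom}f-\operatorname{dom}g$. (iv) $Z=\operatorname{argmin}\big(-\langle\cdot,\mathsf v\rangle+\tfrac r2\|\cdot-w\|^2+\iota_U+\iota_V(\cdot-\mathsf v)\big)=\{\overline{x}\}$. (v) $\mathsf v\in\operatorname{ran}(\mathrm{Id}-T)$. (vi) $\operatorname{Prox}_fx=P_U\big(\tfrac{1}{r+1}x+\tfrac{r}{r+1}w\big)$. (vii) $\operatorname{Prox}_gx=P_Vx$. (viii) Let $\lambda\in\,]0,1]$ and set $T_\lambda=(1-\lambda)\mathrm{Id}+\lambda R_gR_f$. Then: (a) $\operatorname{Prox}_fT_\lambda^nx\to\overline{x}$ as $n\to\infty$; (b) if $\lambda\in\,]0,1[$, then $\operatorname{Prox}_gR_fT_\lambda^nx\to\overline{x}-\mathsf v$ as $n\to\infty$.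
   Context: A subset of $X$ is polyhedral if it is a finite intersection of closed halfspaces. $\iota_U$ is the indicator function of $U$ ($0$ on $U$, $+\infty$ elsewhere). $\operatorname{Prox}_f=(\mathrm{Id}+\partial f)^{-1}$ is the proximal mapping, $R_f=2\operatorname{Prox}_f-\mathrm{Id}$, and similarly for $g$. $P_D$ is the metric projection onto a nonempty closed convex set $D$; $\overline{\operatorname{ran}}(\mathrm{Id}-T)$ is the closure of the range of $\mathrm{Id}-T$, a nonempty closed convex set. $U-V=\{u-v:u\in U,\ v\in V\}$. $\operatorname{argmin}$ denotes the set of minimizers over $X$. *)

theory Defs
  imports "HOL-Analysis.Analysis"
begin

definition indicator_fun :: "'a set \<Rightarrow> 'a \<Rightarrow> ereal" where
  "indicator_fun U x = (if x \<in> U then 0 else \<infinity>)"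

definition eff_domain :: "('a \<Rightarrow> ereal) \<Rightarrow> 'a set" where
  "eff_domain f = {x. f x < \<infinity>}"

definition proper_fun :: "('a \<Rightarrow> ereal) \<Rightarrow> bool" where
  "proper_fun f \<longleftrightarrow> (\<forall>x. f x \<noteq> -\<infinity>) \<and> eff_domain f \<noteq> {}"

definition minimizers :: "('a \<Rightarrow> ereal) \<Rightarrow> 'a set" where
  "minimizers f = {x. \<forall>y. f x \<le> f y}"

text \<open>The defining inequality is only required on the effective domain, where a proper
  function is real-valued, so no indeterminate extended-real arithmetic occurs.\<close>

definition strongly_convex :: "('a::real_inner \<Rightarrow> ereal) \<Rightarrow> bool" where
  "strongly_convex f \<longleftrightarrow> proper_fun f \<and>
     (\<exists>\<beta>>0. \<forall>x\<in>eff_domain f. \<forall>y\<in>eff_domain f. \<forall>\<alpha>. 0 < \<alpha> \<and> \<alpha> < 1 \<longrightarrow>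
        f (\<alpha> *\<^sub>R x + (1 - \<alpha>) *\<^sub>R y) + ereal (\<alpha> * (1 - \<alpha>) * (\<beta> / 2) * (norm (x - y))\<^sup>2)
          \<le> ereal \<alpha> * f x + ereal (1 - \<alpha>) * f y)"

text \<open>For proper \<open>f\<close> this is empty outside the effective domain of \<open>f\<close>.\<close>

definition subdifferential :: "('a::real_inner \<Rightarrow> ereal) \<Rightarrow> 'a \<Rightarrow> 'a set" where
  "subdifferential f x = {u. \<forall>y. ereal ((y - x) \<bullet> u) + f x \<le> f y}"

text \<open>The resolvent of the subdifferential: \<open>prox f x\<close> is the unique \<open>p\<close> whose image under the
  set-valued operator \<open>Id + \<partial>f\<close> contains \<open>x\<close>. The addition below is elementwise addition of
  sets. If no such unique point exists, the value is unspecified.\<close>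

definition prox :: "('a::real_inner \<Rightarrow> ereal) \<Rightarrow> 'a \<Rightarrow> 'a" where
  "prox f x = (THE p. x \<in> {p} + subdifferential f p)"

definition refl_prox :: "('a::real_inner \<Rightarrow> ereal) \<Rightarrow> 'a \<Rightarrow> 'a" where
  "refl_prox f x = 2 *\<^sub>R prox f x - x"

text \<open>Elementwise difference of sets; \<open>U - V\<close> on sets is the set-theoretic difference.\<close>

definition set_sub :: "'a::ab_group_add set \<Rightarrow> 'a set \<Rightarrow> 'a set" where
  "set_sub U V = {u - v | u v. u \<in> U \<and> v \<in> V}"

end

theory Submission
  imports Defs
begin

text \<open>
  A displacement \<open>z - T z\<close> is \<open>Prox\<^sub>f z - Prox\<^sub>g (R\<^sub>f z)\<close>, and it equals \<open>d\<close> exactly when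
  \<open>y = Prox\<^sub>f z\<close> solves \<open>d \<in> \<partial>f(y) + N\<^sub>V(y - d)\<close>. By Farkas' lemma the normal cone of
  \<open>U \<inter> (d + V)\<close> is the sum of the normal cones, so for every \<open>d \<in> U - V\<close> the unique solution is
  the projection of \<open>w + d/r\<close> onto \<open>U \<inter> (d + V)\<close>. Hence the range of \<open>Id - T\<close> is all of \<open>U - V\<close>,
  which is closed, again by Farkas' lemma.

  For the convergence, let \<open>y - T y = v\<close>. Since \<open>v\<close> is the displacement of least norm, all
  iterates \<open>y\<^sub>n\<close> of \<open>y\<close> have displacement \<open>v\<close>, and thus \<open>Prox\<^sub>f y\<^sub>n\<close> is the constant solution.
  Strong convexity of \<open>f\<close> makes the squared distance between the iterates \<open>x\<^sub>n\<close> and \<open>y\<^sub>n\<close>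
  decrease by at least a multiple of the squared distance between \<open>Prox\<^sub>f x\<^sub>n\<close> and \<open>Prox\<^sub>f y\<^sub>n\<close>, even for \<open>\<lambda> = 1\<close>; for
  \<open>\<lambda> < 1\<close> it also decreases by a multiple of the squared distance between the displacements.
\<close>

section \<open>Systems of linear inequalities\<close>

definition ineq_solutions :: "('a::real_inner \<times> real) set \<Rightarrow> 'a set" where
  "ineq_solutions A = {z. \<forall>(a, b)\<in>A. a \<bullet> z \<le> b}"

lemma polyhedron_imp_ineq_solutions:
  assumes "polyhedron S"
  obtains A where "finite A" "S = ineq_solutions A"
proof -
  obtain F where F: "finite F" "S = \<Inter>F" "\<forall>h\<in>F. \<exists>a b. a \<noteq> 0 \<and> h = {x. a \<bullet> x \<le> b}"
    using assms unfolding polyhedron_def by blast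
  then obtain \<alpha> \<beta> where h: "\<forall>h\<in>F. h = {x. \<alpha> h \<bullet> x \<le> \<beta> h}"
    by metis
  have "S = ineq_solutions ((\<lambda>h. (\<alpha> h, \<beta> h)) ` F)"
    using h unfolding F(2) ineq_solutions_def by auto
  with \<open>finite F\<close> show ?thesis
    by (intro that) auto
qed

text \<open>Finitely generated cones are closed, so a hyperplane separates strictly at some level
  \<open>b\<close>; invariance under scaling moves the level to 0.\<close>

lemma convex_cone_hull_separation:
  fixes y :: "'a::euclidean_space"
  assumes "finite S" "y \<notin> convex_cone hull S"
  obtains d where "d \<bullet> y < 0" "\<And>s. s \<in> S \<Longrightarrow> 0 \<le> d \<bullet> s"
proof -
  obtain d b where db: "d \<bullet> y < b" "\<And>s. s \<in> convex_cone hull S \<Longrightarrow> b < d \<bullet> s"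
    using separating_hyperplane_closed_point[OF convex_convex_cone_hull closed_convex_cone_hull]
      assms by metis
  have "b < 0"
    using db(2)[OF convex_cone_hull_contains_0] by simp
  have "0 \<le> d \<bullet> s" if "s \<in> S" for s
  proof (rule ccontr)
    assume neg: "\<not> 0 \<le> d \<bullet> s"
    \<comment> \<open>If \<open>d \<bullet> s\<close> is negative, this multiple of \<open>s\<close>
      lies exactly on the level \<open>b\<close>.\<close>
    have "(b / (d \<bullet> s)) *\<^sub>R s \<in> convex_cone hull S"
      using that neg \<open>b < 0\<close> by (intro convex_cone_hull_mul hull_inc divide_nonpos_nonpos) auto
    from db(2)[OF this] show False
      using neg by simp
  qed
  moreover have "d \<bullet> y < 0"
    using db(1) \<open>b < 0\<close> by simp
  ultimately show ?thesis
    using that by blast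
qed

text \<open>A pair \<open>(q, s)\<close> encodes the inequality \<open>q \<bullet> z \<le> s\<close>; the generator \<open>(0, 1)\<close> allows
  right-hand sides to be weakened.\<close>

definition consequences :: "('a::real_inner \<times> real) set \<Rightarrow> ('a \<times> real) set" where
  "consequences A = convex_cone hull (insert (0, 1) A)"

lemma convex_cone_valid_inequalities: "convex_cone {(q, s). \<forall>z\<in>S. q \<bullet> z \<le> s}"
  unfolding convex_cone_iff
  by (auto simp: inner_simps zero_prod_def intro!: add_mono mult_left_mono)

lemma consequences_valid:
  assumes "(q, s) \<in> consequences A" "z \<in> ineq_solutions A"
  shows "q \<bullet> z \<le> s"
proof -
  have "consequences A \<subseteq> {(q, s). \<forall>z\<in>ineq_solutions A. q \<bullet> z \<le> s}"
    unfolding consequences_def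
    by (intro hull_minimal convex_cone_valid_inequalities) (auto simp: ineq_solutions_def)
  with assms show ?thesis by auto
qed

text \<open>A functional \<open>(d, t)\<close> separating \<open>(0, -1)\<close> from the cone has
  \<open>t > 0\<close>, and then \<open>- d / t\<close> solves the system.\<close>

lemma ineq_solutions_nonempty:
  fixes A :: "('a::euclidean_space \<times> real) set"
  assumes "finite A" "(0, -1) \<notin> consequences A"
  shows "ineq_solutions A \<noteq> {}"
proof -
  obtain e where e: "e \<bullet> (0, -1) < 0" "\<And>s. s \<in> insert (0, 1) A \<Longrightarrow> 0 \<le> e \<bullet> s"
    using convex_cone_hull_separation[of "insert (0, 1) A" "(0, -1)"] assms
    unfolding consequences_def by auto
  obtain d t where dt: "e = (d, t)" by (cases e)
  have t: "t > 0" using e(1) dt by simp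
  have "a \<bullet> ((-1 / t) *\<^sub>R d) \<le> b" if "(a, b) \<in> A" for a b
    using e(2)[of "(a, b)"] that t dt by (simp add: field_simps inner_commute)
  then have "(-1 / t) *\<^sub>R d \<in> ineq_solutions A"
    unfolding ineq_solutions_def by auto
  then show ?thesis by blast
qed

text \<open>Affine Farkas lemma. A separating functional \<open>(d, t)\<close> has
  \<open>t \<ge> 0\<close>. For \<open>t > 0\<close> the point \<open>- d / t\<close> is feasible
  and violates the inequality; for \<open>t = 0\<close> the vector \<open>- d\<close> is a feasible
  direction along which \<open>n\<close> is unbounded above.\<close>

lemma consequences_complete:
  fixes A :: "('a::euclidean_space \<times> real) set"
  assumes "finite A" "ineq_solutions A \<noteq> {}" "\<And>z. z \<in> ineq_solutions A \<Longrightarrow> n \<bullet> z \<le> c"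
  shows "(n, c) \<in> consequences A"
proof (rule ccontr)
  assume "(n, c) \<notin> consequences A"
  then obtain e where e: "e \<bullet> (n, c) < 0" "\<And>s. s \<in> insert (0, 1) A \<Longrightarrow> 0 \<le> e \<bullet> s"
    using convex_cone_hull_separation[of "insert (0, 1) A" "(n, c)"] assms(1)
    unfolding consequences_def by auto
  obtain d t where dt: "e = (d, t)" by (cases e)
  have n: "d \<bullet> n + t * c < 0" using e(1) dt by simp
  have A: "0 \<le> d \<bullet> a + t * b" if "(a, b) \<in> A" for a b
    using e(2)[of "(a, b)"] that dt by simp
  have "t \<ge> 0" using e(2)[of "(0, 1)"] dt by simp
  then consider "t > 0" | "t = 0" by linarith
  then show False
  proof cases
    case 1
    have "a \<bullet> ((-1 / t) *\<^sub>R d) \<le> b" if "(a, b) \<in> A" for a b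
      using A[OF that] 1 by (simp add: field_simps inner_commute)
    then have "(-1 / t) *\<^sub>R d \<in> ineq_solutions A"
      unfolding ineq_solutions_def by auto
    from assms(3)[OF this] show False
      using n 1 by (simp add: field_simps inner_commute)
  next
    case 2
    obtain z where z: "z \<in> ineq_solutions A" using assms(2) by blast
    \<comment> \<open>The quotient raises \<open>n \<bullet> (z - k d)\<close> to \<open>c\<close>;
      the extra 1 overshoots by \<open>- (d \<bullet> n) > 0\<close>.\<close>
    define k where "k = (c - n \<bullet> z) / (- (d \<bullet> n)) + 1"
    have dn: "d \<bullet> n < 0" using n 2 by simp
    have "k \<ge> 0"
      unfolding k_def using assms(3)[OF z] dn by (simp add: field_simps)
    have "z - k *\<^sub>R d \<in> ineq_solutions A"
      unfolding ineq_solutions_def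
    proof safe
      fix a b assume ab: "(a, b) \<in> A"
      have "a \<bullet> z \<le> b" using z ab unfolding ineq_solutions_def by auto
      moreover have "0 \<le> k * (a \<bullet> d)"
        using A[OF ab] 2 \<open>k \<ge> 0\<close> by (simp add: inner_commute)
      ultimately show "a \<bullet> (z - k *\<^sub>R d) \<le> b"
        by (simp add: inner_simps)
    qed
    from assms(3)[OF this] have "n \<bullet> z - k * (d \<bullet> n) \<le> c"
      by (simp add: inner_simps inner_commute)
    moreover have "k * (d \<bullet> n) = n \<bullet> z - c + d \<bullet> n"
      unfolding k_def using dn by (simp add: field_simps)
    ultimately show False using dn by simp
  qed
qed

text \<open>The projection is cut out by those consequences of the system in which the eliminated
  variable has coefficient zero: specialising the remaining variable to \<open>y\<close> is a linear map on
  inequalities, so infeasibility of the specialised system lifts to a consequence violated by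
  \<open>y\<close>.\<close>

lemma closed_snd_ineq_solutions:
  fixes A :: "(('a::euclidean_space \<times> 'b::euclidean_space) \<times> real) set"
  assumes "finite A"
  shows "closed (snd ` ineq_solutions A)"
proof -
  let ?C = "{(q, s). ((0, q), s) \<in> consequences A}"
  have "snd ` ineq_solutions A = (\<Inter>(q, s)\<in>?C. {y. q \<bullet> y \<le> s})"
  proof (intro equalityI subsetI)
    fix y assume "y \<in> snd ` ineq_solutions A"
    then show "y \<in> (\<Inter>(q, s)\<in>?C. {y. q \<bullet> y \<le> s})"
      using consequences_valid by fastforce
  next
    fix y assume y: "y \<in> (\<Inter>(q, s)\<in>?C. {y. q \<bullet> y \<le> s})"
    define L :: "('a \<times> 'b) \<times> real \<Rightarrow> 'a \<times> real"
      where "L = (\<lambda>((p, q), s). (p, s - q \<bullet> y))"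
    have "linear L"
      by (rule linearI) (auto simp: L_def inner_simps algebra_simps split: prod.splits)
    have L01: "L (0, 1) = (0, 1)" by (simp add: L_def zero_prod_def)
    have "consequences (L ` A) = L ` consequences A"
      unfolding consequences_def
      by (subst convex_cone_hull_linear_image[OF \<open>linear L\<close>, symmetric]) (simp add: L01)
    moreover have "(0, -1) \<notin> L ` consequences A"
    proof
      assume "(0, -1) \<in> L ` consequences A"
      then obtain q s where "((0, q), s) \<in> consequences A" "s - q \<bullet> y = -1"
        by (auto simp: L_def split: prod.splits)
      with y show False by fastforce
    qed
    ultimately obtain u where "u \<in> ineq_solutions (L ` A)"
      using ineq_solutions_nonempty[of "L ` A"] assms by auto
    then have "(u, y) \<in> ineq_solutions A"
      unfolding ineq_solutions_def L_def by (force simp: algebra_simps)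
    then show "y \<in> snd ` ineq_solutions A" by force
  qed
  moreover have "closed (\<Inter>(q, s)\<in>?C. {y. q \<bullet> y \<le> s})"
    by (intro closed_INT) (auto simp: closed_halfspace_le)
  ultimately show ?thesis by simp
qed

text \<open>The difference set is the projection onto \<open>y\<close> of the polyhedron of pairs
  \<open>(u, y)\<close> with \<open>u \<in> U\<close> and \<open>u - y \<in> V\<close>.\<close>

lemma closed_set_sub_polyhedron:
  fixes U V :: "'a::euclidean_space set"
  assumes "polyhedron U" "polyhedron V"
  shows "closed (set_sub U V)"
proof -
  obtain A B where A: "finite A" "U = ineq_solutions A" and B: "finite B" "V = ineq_solutions B"
    using assms by (metis polyhedron_imp_ineq_solutions)
  define E :: "(('a \<times> 'a) \<times> real) set"
    where "E = (\<lambda>(a, b). ((a, 0), b)) ` A \<union> (\<lambda>(a, b). ((a, - a), b)) ` B"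
  have E: "ineq_solutions E = {(u, y). u \<in> U \<and> u - y \<in> V}"
    unfolding A B E_def ineq_solutions_def by (force simp: inner_simps)
  have "set_sub U V = snd ` ineq_solutions E"
    unfolding E set_sub_def by (force simp: image_iff)
  moreover have "finite E" using A(1) B(1) by (simp add: E_def)
  ultimately show ?thesis by (simp add: closed_snd_ineq_solutions)
qed

section \<open>Normal cones\<close>

text \<open>Requiring \<open>p \<in> S\<close> makes the cone empty off \<open>S\<close>, in
  agreement with the subdifferential of the indicator of a nonempty set.\<close>

definition normal_cone :: "'a::real_inner set \<Rightarrow> 'a \<Rightarrow> 'a set" where
  "normal_cone S p = {u. p \<in> S \<and> (\<forall>z\<in>S. u \<bullet> (z - p) \<le> 0)}"

lemma normal_cone_scaleR_iff:
  assumes "c > 0"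
  shows "c *\<^sub>R u \<in> normal_cone S p \<longleftrightarrow> u \<in> normal_cone S p"
  using assms by (simp add: normal_cone_def mult_le_0_iff)

text \<open>For the converse, expand the squared distance about \<open>p\<close>: the obtuse-angle
  condition makes the cross term nonnegative.\<close>

lemma closest_point_eq_iff_normal_cone:
  fixes S :: "'a::euclidean_space set"
  assumes "convex S" "closed S" "S \<noteq> {}"
  shows "closest_point S a = p \<longleftrightarrow> a - p \<in> normal_cone S p"
proof
  assume "closest_point S a = p"
  then show "a - p \<in> normal_cone S p"
    using closest_point_dot[OF assms(1,2)] closest_point_in_set[OF assms(2,3)]
    by (auto simp: normal_cone_def)
next
  assume n: "a - p \<in> normal_cone S p"
  have "dist a p \<le> dist a z" if "z \<in> S" for z
  proof -
    have "(a - p) \<bullet> (z - p) \<le> 0" using n that by (simp add: normal_cone_def)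
    moreover have "(norm (a - z))\<^sup>2 = (norm (a - p))\<^sup>2 - 2 * ((a - p) \<bullet> (z - p)) + (norm (z - p))\<^sup>2"
      by (simp add: power2_norm_eq_inner inner_simps inner_commute)
    ultimately have "(norm (a - p))\<^sup>2 \<le> (norm (a - z))\<^sup>2" by (smt (verit) zero_le_power2)
    then show ?thesis by (simp add: dist_norm)
  qed
  then show "closest_point S a = p"
    using closest_point_unique[of S p a] assms n by (auto simp: normal_cone_def)
qed

text \<open>Polyhedrality takes the place of a constraint qualification: Farkas splits the valid
  inequality \<open>n \<bullet> z \<le> n \<bullet> p\<close> into one for \<open>U\<close> and one
  for \<open>W\<close>.\<close>

lemma normal_cone_Int_polyhedron:
  fixes U W :: "'a::euclidean_space set"
  assumes "polyhedron U" "polyhedron W"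
  shows "normal_cone (U \<inter> W) p = normal_cone U p + normal_cone W p"
proof (intro equalityI subsetI)
  fix n assume n: "n \<in> normal_cone (U \<inter> W) p"
  obtain A B where A: "finite A" "U = ineq_solutions A" and B: "finite B" "W = ineq_solutions B"
    using assms by (metis polyhedron_imp_ineq_solutions)
  have AB: "U \<inter> W = ineq_solutions (A \<union> B)"
    unfolding A B ineq_solutions_def by auto
  have p: "p \<in> U" "p \<in> W" using n by (auto simp: normal_cone_def)
  have "(n, n \<bullet> p) \<in> consequences (A \<union> B)"
    by (rule consequences_complete)
      (use A B n in \<open>auto simp: AB[symmetric] normal_cone_def inner_simps\<close>)
  also have "consequences (A \<union> B) = convex_cone hull (insert (0, 1) A \<union> insert (0, 1) B)"
    by (simp add: consequences_def)
  finally obtain q1 s1 q2 s2 where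
      1: "(q1, s1) \<in> consequences A" and 2: "(q2, s2) \<in> consequences B"
      and n_eq: "n = q1 + q2" "n \<bullet> p = s1 + s2"
    unfolding convex_cone_hull_Un consequences_def by auto
  note valid1 = consequences_valid[OF 1, folded A(2)]
  note valid2 = consequences_valid[OF 2, folded B(2)]
  \<comment> \<open>Two upper bounds attained in sum at \<open>p\<close> are attained
    separately.\<close>
  have tight: "q1 \<bullet> p = s1" "q2 \<bullet> p = s2"
    using valid1[OF p(1)] valid2[OF p(2)] n_eq by (auto simp: inner_simps)
  have "q1 \<in> normal_cone U p" "q2 \<in> normal_cone W p"
    using valid1 valid2 p tight by (auto simp: normal_cone_def inner_simps)
  then show "n \<in> normal_cone U p + normal_cone W p"
    using n_eq(1) by blast
next
  fix n assume "n \<in> normal_cone U p + normal_cone W p"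
  then show "n \<in> normal_cone (U \<inter> W) p"
    by (auto simp: normal_cone_def inner_simps elim!: set_plus_elim) (smt (verit))
qed

lemma normal_cone_translation: "normal_cone {y. y - c \<in> S} p = normal_cone S (p - c)"
proof -
  have "(\<forall>z. z - c \<in> S \<longrightarrow> u \<bullet> (z - p) \<le> 0) \<longleftrightarrow> (\<forall>z\<in>S. u \<bullet> (z - (p - c)) \<le> 0)" for u
    by (metis (no_types, lifting) add_diff_cancel_right' diff_diff_eq2)
  then show ?thesis by (simp add: normal_cone_def)
qed

lemma polyhedron_translation:
  fixes S :: "'a::euclidean_space set"
  assumes "polyhedron S"
  shows "polyhedron {y. y - c \<in> S}"
proof -
  obtain F where F: "finite F" "S = \<Inter>F" "\<And>h. h \<in> F \<Longrightarrow> \<exists>a b. h = {x. a \<bullet> x \<le> b}"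
    using assms unfolding polyhedron_def by metis
  have "{y. y - c \<in> S} = \<Inter>((\<lambda>h. {y. y - c \<in> h}) ` F)"
    unfolding F(2) by auto
  moreover have "polyhedron {y. y - c \<in> h}" if "h \<in> F" for h
  proof -
    obtain a b where h: "h = {x. a \<bullet> x \<le> b}" using F(3)[OF \<open>h \<in> F\<close>] by blast
    have "{y. y - c \<in> h} = {x. a \<bullet> x \<le> b + a \<bullet> c}"
      unfolding h by (auto simp: inner_simps)
    then show ?thesis by (simp add: polyhedron_halfspace_le)
  qed
  ultimately show ?thesis
    using F(1) by (auto intro!: polyhedron_Inter)
qed

section \<open>Relaxed iterations of nonexpansive maps\<close>

lemma norm_sq_convex_combination:
  fixes a b :: "'a::real_inner"
  shows "(norm ((1 - l) *\<^sub>R a + l *\<^sub>R b))\<^sup>2 =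
    (1 - l) * (norm a)\<^sup>2 + l * (norm b)\<^sup>2 - l * (1 - l) * (norm (a - b))\<^sup>2"
  by (simp add: power2_norm_eq_inner inner_simps inner_commute algebra_simps)

text \<open>Displacements of a nonexpansive map do not grow along the iteration, so the unique
  displacement \<open>d\<close> of least norm, once attained, persists.\<close>

lemma relaxed_iterates_displacement:
  fixes R :: "'a::real_normed_vector \<Rightarrow> 'a"
  assumes nonexp: "\<And>a b. norm (R a - R b) \<le> norm (a - b)"
    and least: "\<And>u. norm (u - R u) \<le> norm d \<Longrightarrow> u - R u = d"
    and l: "0 \<le> l" "l \<le> 1"
    and y: "y - R y = d"
  defines "S \<equiv> \<lambda>z. (1 - l) *\<^sub>R z + l *\<^sub>R R z"
  shows "(S ^^ n) y - R ((S ^^ n) y) = d"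
proof (induction n)
  case 0
  then show ?case using y by simp
next
  case (Suc n)
  let ?z = "(S ^^ n) y"
  \<comment> \<open>The first summand has norm \<open>(1 - l) |d|\<close>, the second at most
    \<open>|?z - S ?z| = l |d|\<close>, so the new displacement is no longer than
    \<open>d\<close>.\<close>
  have "S ?z - R (S ?z) = (1 - l) *\<^sub>R d + (R ?z - R (S ?z))"
    unfolding Suc.IH[symmetric] by (simp add: S_def algebra_simps)
  also have "norm \<dots> \<le> (1 - l) * norm d + norm (?z - S ?z)"
    using l by (intro order.trans[OF norm_triangle_ineq] add_mono nonexp) simp
  also have "?z - S ?z = l *\<^sub>R d"
    unfolding Suc.IH[symmetric] by (simp add: S_def algebra_simps)
  also have "(1 - l) * norm d + norm (l *\<^sub>R d) = norm d"
    using l by (simp add: algebra_simps)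
  finally show ?case by (simp add: least)
qed

text \<open>A nonincreasing nonnegative \<open>D\<close> converges, so its decrements vanish, and
  they dominate \<open>e\<close>.\<close>

lemma telescoping_bound_tendsto_zero:
  fixes D e :: "nat \<Rightarrow> real"
  assumes "\<And>n. 0 \<le> D n" "\<And>n. 0 \<le> e n" "\<And>n. D (Suc n) + e n \<le> D n"
  shows "e \<longlonglongrightarrow> 0"
proof -
  have "decseq D"
    using assms(2,3) by (intro decseq_SucI) (smt (verit))
  then obtain L where L: "D \<longlonglongrightarrow> L"
    using decseq_convergent[of D 0] assms(1) by blast
  have "(\<lambda>n. D n - D (Suc n)) \<longlonglongrightarrow> L - L"
    by (intro tendsto_diff L LIMSEQ_Suc)
  then have "(\<lambda>n. D n - D (Suc n)) \<longlonglongrightarrow> 0" by simp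
  then show ?thesis
    by (rule tendsto_sandwich[OF _ _ tendsto_const, rotated 2])
      (use assms(2,3) in \<open>auto simp: algebra_simps\<close>)
qed

text \<open>The squared distance of two orbits loses two nonnegative terms per step, and both must
  vanish; the coefficient \<open>l * (1 - l)\<close> of the second is positive only for
  \<open>l < 1\<close>.\<close>

lemma relaxed_iterates_tendsto:
  fixes R P :: "'a::real_inner \<Rightarrow> 'a"
  assumes strong: "\<And>a b. (norm (R a - R b))\<^sup>2 + c * (norm (P a - P b))\<^sup>2 \<le> (norm (a - b))\<^sup>2"
    and c: "c > 0" and l: "0 < l" "l \<le> 1"
  defines "S \<equiv> \<lambda>z. (1 - l) *\<^sub>R z + l *\<^sub>R R z"
  shows "(\<lambda>n. P ((S ^^ n) x) - P ((S ^^ n) y)) \<longlonglongrightarrow> 0"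
    and "l < 1 \<Longrightarrow> (\<lambda>n. ((S ^^ n) x - R ((S ^^ n) x)) - ((S ^^ n) y - R ((S ^^ n) y))) \<longlonglongrightarrow> 0"
proof -
  define X where "X = (\<lambda>n. (S ^^ n) x)"
  define Y where "Y = (\<lambda>n. (S ^^ n) y)"
  define p where "p = (\<lambda>n. P (X n) - P (Y n))"
  define q where "q = (\<lambda>n. (X n - R (X n)) - (Y n - R (Y n)))"
  have step: "(norm (S a - S b))\<^sup>2 + (l * c * (norm (P a - P b))\<^sup>2
      + l * (1 - l) * (norm ((a - R a) - (b - R b)))\<^sup>2) \<le> (norm (a - b))\<^sup>2" for a b
  proof -
    have "S a - S b = (1 - l) *\<^sub>R (a - b) + l *\<^sub>R (R a - R b)"
      by (simp add: S_def algebra_simps)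
    moreover have "(a - b) - (R a - R b) = (a - R a) - (b - R b)"
      by simp
    ultimately have "(norm (S a - S b))\<^sup>2 = (1 - l) * (norm (a - b))\<^sup>2 + l * (norm (R a - R b))\<^sup>2
        - l * (1 - l) * (norm ((a - R a) - (b - R b)))\<^sup>2"
      by (metis norm_sq_convex_combination)
    moreover have "l * ((norm (R a - R b))\<^sup>2 + c * (norm (P a - P b))\<^sup>2) \<le> l * (norm (a - b))\<^sup>2"
      using l by (intro mult_left_mono strong) simp
    ultimately show ?thesis by (simp add: algebra_simps)
  qed
  have lim: "(\<lambda>n. l * c * (norm (p n))\<^sup>2 + l * (1 - l) * (norm (q n))\<^sup>2) \<longlonglongrightarrow> 0"
    by (rule telescoping_bound_tendsto_zero[where D = "\<lambda>n. (norm (X n - Y n))\<^sup>2"])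
      (use step l c in \<open>auto simp: X_def Y_def p_def q_def\<close>)
  have part: "u \<longlonglongrightarrow> 0"
    if "k > 0" and bound: "\<And>n. k * (norm (u n))\<^sup>2 \<le> l * c * (norm (p n))\<^sup>2 + l * (1 - l) * (norm (q n))\<^sup>2"
    for k and u :: "nat \<Rightarrow> 'a"
  proof -
    have "(\<lambda>n. k * (norm (u n))\<^sup>2) \<longlonglongrightarrow> 0"
      by (rule tendsto_sandwich[OF _ _ tendsto_const lim]) (use that in auto)
    from tendsto_mult_left[OF this, of "1 / k"] have "(\<lambda>n. (norm (u n))\<^sup>2) \<longlonglongrightarrow> 0"
      using \<open>k > 0\<close> by simp
    from tendsto_real_sqrt[OF this] show ?thesis
      by (simp add: tendsto_norm_zero_iff)
  qed
  have "p \<longlonglongrightarrow> 0"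
    by (rule part[of "l * c"]) (use l c in auto)
  then show "(\<lambda>n. P ((S ^^ n) x) - P ((S ^^ n) y)) \<longlonglongrightarrow> 0"
    by (simp add: p_def X_def Y_def)
  assume "l < 1"
  have "q \<longlonglongrightarrow> 0"
    by (rule part[of "l * (1 - l)"]) (use l c \<open>l < 1\<close> in auto)
  then show "(\<lambda>n. ((S ^^ n) x - R ((S ^^ n) x)) - ((S ^^ n) y - R ((S ^^ n) y))) \<longlonglongrightarrow> 0"
    by (simp add: q_def X_def Y_def)
qed

section \<open>Subdifferentials and proximal mappings\<close>

lemma normal_cone_monotone:
  assumes "u \<in> normal_cone S p" "u' \<in> normal_cone S p'"
  shows "0 \<le> (u - u') \<bullet> (p - p')"
proof -
  have "u \<bullet> (p' - p) \<le> 0" "u' \<bullet> (p - p') \<le> 0"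
    using assms by (auto simp: normal_cone_def)
  then show ?thesis by (simp add: inner_simps)
qed

text \<open>Comparison with a point of \<open>S\<close> forces \<open>p \<in> S\<close>; for empty
  \<open>S\<close> the indicator is constantly infinite and every vector is a subgradient.\<close>

lemma subdifferential_indicator_fun:
  assumes "S \<noteq> {}"
  shows "subdifferential (indicator_fun S) p = normal_cone S p"
proof -
  obtain s where "s \<in> S" using assms by blast
  show ?thesis
  proof (intro equalityI subsetI)
    fix u assume "u \<in> subdifferential (indicator_fun S) p"
    then have u: "ereal ((z - p) \<bullet> u) + indicator_fun S p \<le> indicator_fun S z" for z
      by (simp add: subdifferential_def)
    have "p \<in> S" using u[of s] \<open>s \<in> S\<close> by (auto simp: indicator_fun_def split: if_splits)
    moreover have "u \<bullet> (z - p) \<le> 0" if "z \<in> S" for z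
      using u[of z] that \<open>p \<in> S\<close> by (simp add: indicator_fun_def inner_commute)
    ultimately show "u \<in> normal_cone S p" by (simp add: normal_cone_def)
  next
    fix u assume "u \<in> normal_cone S p"
    then show "u \<in> subdifferential (indicator_fun S) p"
      by (auto simp: subdifferential_def indicator_fun_def normal_cone_def inner_commute)
  qed
qed

text \<open>Let \<open>t\<close> decrease to 0. This removes the second-order term when a
  subgradient inequality is tested along short segments.\<close>

lemma nonpos_if_le_small_multiples:
  fixes c k :: real
  assumes "\<And>t. 0 < t \<Longrightarrow> t \<le> 1 \<Longrightarrow> c \<le> t * k"
  shows "c \<le> 0"
proof -
  have "((\<lambda>t. t * k) \<longlongrightarrow> 0 * k) (at_right 0)"
    by (intro tendsto_intros)
  moreover have "\<forall>\<^sub>F t in at_right 0. c \<le> t * k"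
    using eventually_at_right_less[of "0::real"] eventually_at_right_real[of 0 "1::real", OF zero_less_one]
    by eventually_elim (use assms in auto)
  ultimately show ?thesis
    using tendsto_lowerbound[of "\<lambda>t. t * k" "0 * k" "at_right 0" c] by simp
qed

section \<open>Quadratic functions restricted to a convex set\<close>

definition quad_indicator :: "real \<Rightarrow> 'a::real_inner \<Rightarrow> 'a set \<Rightarrow> 'a \<Rightarrow> ereal" where
  "quad_indicator r w S = (\<lambda>y. ereal (r / 2 * (norm (y - w))\<^sup>2) + indicator_fun S y)"

lemma quad_indicator_simps:
  "y \<in> S \<Longrightarrow> quad_indicator r w S y = ereal (r / 2 * (norm (y - w))\<^sup>2)"
  "y \<notin> S \<Longrightarrow> quad_indicator r w S y = \<infinity>"
  by (simp_all add: quad_indicator_def indicator_fun_def)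

lemma eff_domain_indicator_fun: "eff_domain (indicator_fun S) = S"
  by (auto simp: eff_domain_def indicator_fun_def)

lemma eff_domain_quad_indicator: "eff_domain (quad_indicator r w S) = S"
  by (auto simp: eff_domain_def quad_indicator_def indicator_fun_def)

text \<open>The modulus is \<open>r\<close>: the identity for the squared norm of a convex
  combination gives the defining inequality with equality.\<close>

lemma strongly_convex_quad_indicator:
  assumes "convex S" "S \<noteq> {}" "r > 0"
  shows "strongly_convex (quad_indicator r w S)"
  unfolding strongly_convex_def eff_domain_quad_indicator
proof (intro conjI exI[of _ r] ballI allI impI)
  show "proper_fun (quad_indicator r w S)"
    unfolding proper_fun_def eff_domain_quad_indicator
    using assms by (auto simp: quad_indicator_def indicator_fun_def)
next
  fix x y and \<alpha> :: real assume *: "x \<in> S" "y \<in> S" "0 < \<alpha> \<and> \<alpha> < 1"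
  let ?z = "\<alpha> *\<^sub>R x + (1 - \<alpha>) *\<^sub>R y"
  have "?z \<in> S" using * assms(1) by (intro convexD) auto
  have z: "?z - w = (1 - \<alpha>) *\<^sub>R (y - w) + \<alpha> *\<^sub>R (x - w)"
    by (simp add: algebra_simps)
  have eq: "(norm (?z - w))\<^sup>2 = (1 - \<alpha>) * (norm (y - w))\<^sup>2 + \<alpha> * (norm (x - w))\<^sup>2
      - \<alpha> * (1 - \<alpha>) * (norm (x - y))\<^sup>2"
    unfolding z norm_sq_convex_combination by (simp add: norm_minus_commute)
  have "r / 2 * (norm (?z - w))\<^sup>2 + \<alpha> * (1 - \<alpha>) * (r / 2) * (norm (x - y))\<^sup>2
      = \<alpha> * (r / 2 * (norm (x - w))\<^sup>2) + (1 - \<alpha>) * (r / 2 * (norm (y - w))\<^sup>2)"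
    unfolding eq by (simp add: field_simps)
  then show "quad_indicator r w S ?z + ereal (\<alpha> * (1 - \<alpha>) * (r / 2) * (norm (x - y))\<^sup>2)
      \<le> ereal \<alpha> * quad_indicator r w S x + ereal (1 - \<alpha>) * quad_indicator r w S y"
    using * \<open>?z \<in> S\<close> by (simp add: quad_indicator_simps)
qed (use assms in auto)

text \<open>The quadratic has gradient \<open>r (p - w)\<close>. Forward, the inequality is tested
  along segments from \<open>p\<close>; backward, the nonnegative square in the expansion about
  \<open>p\<close> is dropped.\<close>

lemma subdifferential_quad_indicator_iff:
  assumes "convex S" "S \<noteq> {}" "r > 0"
  shows "u \<in> subdifferential (quad_indicator r w S) p \<longleftrightarrow> u - r *\<^sub>R (p - w) \<in> normal_cone S p"
proof -
  have expand: "(norm (z - w))\<^sup>2 = (norm (p - w))\<^sup>2 + 2 * ((p - w) \<bullet> (z - p)) + (norm (z - p))\<^sup>2" for z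
    by (simp add: power2_norm_eq_inner inner_simps inner_commute)
  show ?thesis
  proof
    assume "u \<in> subdifferential (quad_indicator r w S) p"
    then have u: "ereal ((z - p) \<bullet> u) + quad_indicator r w S p \<le> quad_indicator r w S z" for z
      by (simp add: subdifferential_def)
    obtain s where "s \<in> S" using assms by blast
    have "p \<in> S"
      using u[of s] \<open>s \<in> S\<close> by (auto simp: quad_indicator_simps intro: ccontr)
    moreover have "(u - r *\<^sub>R (p - w)) \<bullet> (z - p) \<le> 0" if "z \<in> S" for z
    proof (rule nonpos_if_le_small_multiples)
      fix t :: real assume t: "0 < t" "t \<le> 1"
      \<comment> \<open>Every first-order term carries one factor \<open>t\<close> and the square
        carries two; dividing by \<open>t\<close> leaves a bound that tends to 0.\<close>
      let ?y = "p + t *\<^sub>R (z - p)"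
      have "?y = (1 - t) *\<^sub>R p + t *\<^sub>R z" by (simp add: algebra_simps)
      then have "?y \<in> S" using assms(1) \<open>p \<in> S\<close> \<open>z \<in> S\<close> t by (simp add: convexD)
      then have "t * ((z - p) \<bullet> u) + r / 2 * (norm (p - w))\<^sup>2 \<le> r / 2 * (norm (?y - w))\<^sup>2"
        using u[of ?y] \<open>p \<in> S\<close> by (simp add: quad_indicator_simps)
      moreover have "(norm (?y - w))\<^sup>2
          = (norm (p - w))\<^sup>2 + 2 * (t * ((p - w) \<bullet> (z - p))) + t * (t * (norm (z - p))\<^sup>2)"
        unfolding expand[of ?y] by (simp add: power2_eq_square)
      ultimately have "t * ((z - p) \<bullet> u)
          \<le> r * (t * ((p - w) \<bullet> (z - p))) + r / 2 * (t * (t * (norm (z - p))\<^sup>2))"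
        by (simp add: distrib_left)
      then have "t * ((u - r *\<^sub>R (p - w)) \<bullet> (z - p)) \<le> t * (t * (r / 2 * (norm (z - p))\<^sup>2))"
        by (simp add: inner_diff_left inner_commute[of u] right_diff_distrib mult.left_commute)
      then show "(u - r *\<^sub>R (p - w)) \<bullet> (z - p) \<le> t * (r / 2 * (norm (z - p))\<^sup>2)"
        using t by simp
    qed
    ultimately show "u - r *\<^sub>R (p - w) \<in> normal_cone S p"
      by (simp add: normal_cone_def)
  next
    assume n: "u - r *\<^sub>R (p - w) \<in> normal_cone S p"
    then have "p \<in> S" by (simp add: normal_cone_def)
    have "ereal ((z - p) \<bullet> u) + quad_indicator r w S p \<le> quad_indicator r w S z" for z
    proof (cases "z \<in> S")
      case True
      have "u \<bullet> (z - p) \<le> r * ((p - w) \<bullet> (z - p))"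
        using n True by (simp add: normal_cone_def inner_diff_left)
      moreover have "0 \<le> r / 2 * (norm (z - p))\<^sup>2" using assms by simp
      ultimately have "u \<bullet> (z - p) + r / 2 * (norm (p - w))\<^sup>2 \<le> r / 2 * (norm (z - w))\<^sup>2"
        unfolding expand[of z] by (simp add: algebra_simps)
      then show ?thesis
        using True \<open>p \<in> S\<close> by (simp add: quad_indicator_simps inner_commute)
    qed (simp add: quad_indicator_simps)
    then show "u \<in> subdifferential (quad_indicator r w S) p"
      by (simp add: subdifferential_def)
  qed
qed

section \<open>Resolvents as metric projections\<close>

lemma mem_singleton_plus_iff:
  fixes x p :: "'a::ab_group_add"
  shows "x \<in> {p} + B \<longleftrightarrow> x - p \<in> B"
proof -
  have "x \<in> {p} + B \<longleftrightarrow> (\<exists>b\<in>B. x = p + b)"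
    by (auto simp: set_plus_def)
  also have "\<dots> \<longleftrightarrow> x - p \<in> B"
    by (metis add_diff_cancel_left' add.commute diff_add_cancel)
  finally show ?thesis .
qed

text \<open>The resolvent inclusion is the projection criterion, so \<open>THE\<close> has exactly
  one candidate.\<close>

lemma prox_indicator_fun:
  fixes S :: "'a::euclidean_space set"
  assumes "convex S" "closed S" "S \<noteq> {}"
  shows "prox (indicator_fun S) x = closest_point S x"
  unfolding prox_def mem_singleton_plus_iff
  by (simp add: subdifferential_indicator_fun closest_point_eq_iff_normal_cone[symmetric] assms)

text \<open>The vector on the right is \<open>r + 1\<close> times the weighted mean minus
  \<open>p\<close>, and normal cones absorb positive factors.\<close>

lemma closest_point_weighted_eq_iff:
  fixes S :: "'a::euclidean_space set"
  assumes "convex S" "closed S" "S \<noteq> {}" "r > 0"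
  shows "closest_point S ((1 / (r + 1)) *\<^sub>R x + (r / (r + 1)) *\<^sub>R w) = p
    \<longleftrightarrow> x - p - r *\<^sub>R (p - w) \<in> normal_cone S p"
proof -
  let ?m = "(1 / (r + 1)) *\<^sub>R x + (r / (r + 1)) *\<^sub>R w"
  have "(r + 1) *\<^sub>R (?m - p) = (r + 1) *\<^sub>R ?m - (r + 1) *\<^sub>R p"
    by (rule scaleR_diff_right)
  also have "(r + 1) *\<^sub>R ?m = x + r *\<^sub>R w"
    using assms(4) by (simp add: scaleR_right_distrib)
  finally have "x - p - r *\<^sub>R (p - w) = (r + 1) *\<^sub>R (?m - p)"
    by (simp add: algebra_simps)
  then show ?thesis
    using normal_cone_scaleR_iff[of "r + 1" "?m - p" S p] assms
    by (simp add: closest_point_eq_iff_normal_cone)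
qed

lemma prox_quad_indicator:
  fixes S :: "'a::euclidean_space set"
  assumes "convex S" "closed S" "S \<noteq> {}" "r > 0"
  shows "prox (quad_indicator r w S) x = closest_point S ((1 / (r + 1)) *\<^sub>R x + (r / (r + 1)) *\<^sub>R w)"
  unfolding prox_def mem_singleton_plus_iff
  by (simp add: subdifferential_quad_indicator_iff closest_point_weighted_eq_iff[symmetric] assms)

text \<open>Meant for a difference \<open>a\<close> of inputs and \<open>p\<close> of resolvent
  values: the squared norms of \<open>a\<close> and \<open>2 p - a\<close> differ by
  \<open>4 (a - p) \<bullet> p\<close>, which is at least \<open>4 r |p|^2\<close>.\<close>

lemma reflection_contraction:
  fixes a :: "'a::real_inner"
  assumes "0 \<le> (a - (1 + r) *\<^sub>R p) \<bullet> p"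
  shows "(norm (2 *\<^sub>R p - a))\<^sup>2 + 4 * r * (norm p)\<^sup>2 \<le> (norm a)\<^sup>2"
  using assms by (simp add: power2_norm_eq_inner inner_simps inner_commute algebra_simps)

lemma minimizers_dist_sq:
  fixes K :: "'a::euclidean_space set"
  assumes "convex K" "closed K" "K \<noteq> {}" "r > 0"
  shows "minimizers (\<lambda>y. if y \<in> K then ereal (r / 2 * (dist m y)\<^sup>2 + c) else \<infinity>) = {closest_point K m}"
    (is "minimizers ?\<phi> = _")
proof (intro equalityI subsetI)
  fix y assume y: "y \<in> minimizers ?\<phi>"
  obtain k where "k \<in> K" using assms by blast
  have le: "?\<phi> y \<le> ?\<phi> z" for z using y by (simp add: minimizers_def)
  have "y \<in> K" using le[of k] \<open>k \<in> K\<close> by (auto split: if_splits)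
  moreover have "\<forall>z\<in>K. dist m y \<le> dist m z"
  proof
    fix z assume "z \<in> K"
    then show "dist m y \<le> dist m z" using le[of z] \<open>y \<in> K\<close> assms(4) by simp
  qed
  ultimately show "y \<in> {closest_point K m}"
    using closest_point_unique[OF assms(1,2)] by blast
next
  fix y assume "y \<in> {closest_point K m}"
  then have "y \<in> K" "\<forall>z\<in>K. dist m y \<le> dist m z"
    using closest_point_exists[OF assms(2,3)] by auto
  then show "y \<in> minimizers ?\<phi>"
    using assms(4) by (auto simp: minimizers_def)
qed

section \<open>The Douglas--Rachford operator of a polyhedral pair\<close>

locale polyhedral_pair =
  fixes U V :: "'a::euclidean_space set" and w :: 'a and r :: real
  assumes polyhedron: "polyhedron U" "polyhedron V"
    and nonempty: "U \<noteq> {}" "V \<noteq> {}"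
    and r_pos: "r > 0"
begin

abbreviation "f \<equiv> quad_indicator r w U"
abbreviation "g \<equiv> indicator_fun V"

text \<open>\<open>T\<close> is the average of this map and the identity, so displacements of
  \<open>R\<close> are twice those of \<open>T\<close>.\<close>

definition R :: "'a \<Rightarrow> 'a" where
  "R y = refl_prox g (refl_prox f y)"

definition overlap :: "'a \<Rightarrow> 'a set" where
  "overlap d = {y \<in> U. y - d \<in> V}"

text \<open>Completing the square in \<open>- (y \<bullet> d) + r/2 |y - w|^2\<close> gives the
  centre \<open>w + d / r\<close>.\<close>

definition normal_solution :: "'a \<Rightarrow> 'a" where
  "normal_solution d = closest_point (overlap d) (w + (1 / r) *\<^sub>R d)"

lemmas convex = polyhedron[THEN polyhedron_imp_convex]
lemmas closed = polyhedron[THEN polyhedron_imp_closed]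
lemmas prox_f = prox_quad_indicator[OF convex(1) closed(1) nonempty(1) r_pos]
lemmas prox_g = prox_indicator_fun[OF convex(2) closed(2) nonempty(2)]

lemma prox_f_eq_iff: "prox f x = p \<longleftrightarrow> x - p - r *\<^sub>R (p - w) \<in> normal_cone U p"
  unfolding prox_f
  by (rule closest_point_weighted_eq_iff[OF convex(1) closed(1) nonempty(1) r_pos])

lemma prox_g_eq_iff: "prox g x = p \<longleftrightarrow> x - p \<in> normal_cone V p"
  unfolding prox_g by (rule closest_point_eq_iff_normal_cone[OF convex(2) closed(2) nonempty(2)])

lemma diff_R: "y - R y = 2 *\<^sub>R (prox f y - prox g (refl_prox f y))"
  by (simp add: R_def refl_prox_def algebra_simps scaleR_2)

text \<open>\<open>reflection_contraction\<close> handles both reflections: with modulus 0 for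
  \<open>g\<close>, and with modulus \<open>r\<close> for \<open>f\<close>, whose surplus survives
  the composition.\<close>

lemma R_contraction:
  "(norm (R a - R b))\<^sup>2 + 4 * r * (norm (prox f a - prox f b))\<^sup>2 \<le> (norm (a - b))\<^sup>2"
proof -
  let ?a = "refl_prox f a" and ?b = "refl_prox f b"
  have "0 \<le> ((?a - prox g ?a) - (?b - prox g ?b)) \<bullet> (prox g ?a - prox g ?b)"
    by (intro normal_cone_monotone[of _ V]) (simp_all add: prox_g_eq_iff[symmetric])
  then have "0 \<le> ((?a - ?b) - (1 + 0) *\<^sub>R (prox g ?a - prox g ?b)) \<bullet> (prox g ?a - prox g ?b)"
    by (simp add: algebra_simps)
  from reflection_contraction[OF this] have 1: "(norm (R a - R b))\<^sup>2 \<le> (norm (?a - ?b))\<^sup>2"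
    by (simp add: R_def refl_prox_def[of g] algebra_simps)
  have "0 \<le> ((a - prox f a - r *\<^sub>R (prox f a - w)) - (b - prox f b - r *\<^sub>R (prox f b - w)))
      \<bullet> (prox f a - prox f b)"
    by (intro normal_cone_monotone[of _ U]) (simp_all add: prox_f_eq_iff[symmetric])
  then have "0 \<le> ((a - b) - (1 + r) *\<^sub>R (prox f a - prox f b)) \<bullet> (prox f a - prox f b)"
    by (simp add: algebra_simps)
  from reflection_contraction[OF this]
  have "(norm (?a - ?b))\<^sup>2 + 4 * r * (norm (prox f a - prox f b))\<^sup>2 \<le> (norm (a - b))\<^sup>2"
    by (simp add: refl_prox_def algebra_simps)
  with 1 show ?thesis by linarith
qed

lemma R_nonexpansive: "norm (R a - R b) \<le> norm (a - b)"
proof -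
  have "0 \<le> 4 * r * (norm (prox f a - prox f b))\<^sup>2" using r_pos by simp
  then have "(norm (R a - R b))\<^sup>2 \<le> (norm (a - b))\<^sup>2"
    using R_contraction[of a b] by linarith
  then show ?thesis by simp
qed

section \<open>Perturbed problems and the range of displacements\<close>

lemma overlap_eq: "overlap d = U \<inter> {y. y - d \<in> V}"
  by (auto simp: overlap_def)

lemma polyhedron_overlap: "polyhedron (overlap d)"
  unfolding overlap_eq using polyhedron polyhedron_translation by blast

lemma overlap_nonempty: "d \<in> set_sub U V \<Longrightarrow> overlap d \<noteq> {}"
  by (force simp: overlap_def set_sub_def)

text \<open>The sum rule merges both normal cones into that of \<open>overlap d\<close>; up to the
  factor \<open>r\<close>, the inclusion becomes the projection criterion. For \<open>d = v\<close>
  the left side is \<open>Z\<close>.\<close>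

lemma normal_solutions:
  assumes "d \<in> set_sub U V"
  shows "{y. 0 \<in> {- d} + subdifferential f y + subdifferential g (y - d)} = {normal_solution d}"
proof -
  have "0 \<in> {- d} + subdifferential f y + subdifferential g (y - d)
      \<longleftrightarrow> y = normal_solution d" for y
  proof -
    have "0 \<in> {- d} + subdifferential f y + subdifferential g (y - d)
        \<longleftrightarrow> d \<in> subdifferential f y + normal_cone V (y - d)"
      by (simp add: add.assoc mem_singleton_plus_iff subdifferential_indicator_fun nonempty)
    also have "\<dots> \<longleftrightarrow> d - r *\<^sub>R (y - w) \<in> normal_cone U y + normal_cone V (y - d)"
    proof -
      have "subdifferential f y = {r *\<^sub>R (y - w)} + normal_cone U y"
        by (auto simp: mem_singleton_plus_iff
            subdifferential_quad_indicator_iff[OF convex(1) nonempty(1) r_pos])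
      then show ?thesis by (simp add: add.assoc mem_singleton_plus_iff)
    qed
    also have "normal_cone U y + normal_cone V (y - d) = normal_cone (overlap d) y"
      by (simp add: overlap_eq normal_cone_Int_polyhedron polyhedron polyhedron_translation
          normal_cone_translation)
    also have "d - r *\<^sub>R (y - w) = r *\<^sub>R (w + (1 / r) *\<^sub>R d - y)"
      using r_pos by (simp add: algebra_simps)
    also have "\<dots> \<in> normal_cone (overlap d) y \<longleftrightarrow> normal_solution d = y"
      unfolding normal_solution_def normal_cone_scaleR_iff[OF r_pos]
      using polyhedron_overlap overlap_nonempty[OF assms]
      by (intro closest_point_eq_iff_normal_cone[symmetric])
        (auto intro: polyhedron_imp_convex polyhedron_imp_closed)
    finally show ?thesis by auto
  qed
  then show ?thesis by auto
qed

text \<open>The resolvent inclusions at \<open>z\<close> and at its reflection involve the vectors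
  \<open>z - ?p\<close> and \<open>?p - z + d\<close>, which add up to \<open>d\<close>; their sum
  is the inclusion of \<open>normal_solutions\<close>.\<close>

lemma displacement_imp_normal_solution:
  assumes "prox f z - prox g (refl_prox f z) = d"
  shows "d \<in> set_sub U V" "prox f z = normal_solution d"
proof -
  let ?p = "prox f z"
  have q: "prox g (refl_prox f z) = ?p - d" using assms by (simp add: algebra_simps)
  have "?p \<in> U" "?p - d \<in> V"
    using prox_f_eq_iff[of z ?p] prox_g_eq_iff[of "refl_prox f z" "?p - d"] q
    by (auto simp: normal_cone_def)
  then show d: "d \<in> set_sub U V"
    unfolding set_sub_def by force
  have "z - ?p \<in> subdifferential f ?p"
    using prox_f_eq_iff[of z ?p]
    by (simp add: subdifferential_quad_indicator_iff[OF convex(1) nonempty(1) r_pos])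
  moreover have "?p - z + d \<in> subdifferential g (?p - d)"
    using prox_g_eq_iff[of "refl_prox f z" "?p - d"] q
    by (simp add: subdifferential_indicator_fun nonempty refl_prox_def scaleR_2 algebra_simps)
  ultimately have "- d + (z - ?p) + (?p - z + d)
      \<in> {- d} + subdifferential f ?p + subdifferential g (?p - d)"
    by (intro set_plus_intro) auto
  then have "?p \<in> {y. 0 \<in> {- d} + subdifferential f y + subdifferential g (y - d)}"
    by simp
  then show "?p = normal_solution d" unfolding normal_solutions[OF d] by simp
qed

lemma displacement_attained:
  assumes "d \<in> set_sub U V"
  obtains z where "prox f z - prox g (refl_prox f z) = d"
proof -
  let ?p = "normal_solution d"
  have "0 \<in> {- d} + subdifferential f ?p + subdifferential g (?p - d)"
    using normal_solutions[OF assms] by blast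
  then obtain s t where s: "s \<in> subdifferential f ?p" and t: "t \<in> subdifferential g (?p - d)"
    and st: "s + t = d"
    by (auto elim!: set_plus_elim simp: algebra_simps)
  \<comment> \<open>Adding \<open>s\<close> makes \<open>?p\<close> the prox of \<open>z\<close>;
    the reflection is then \<open>?p - s\<close>, which differs from \<open>?p - d\<close> by
    \<open>d - s = t\<close>.\<close>
  define z where "z = ?p + s"
  have "prox f z = ?p"
    using s by (simp add: prox_f_eq_iff z_def
        subdifferential_quad_indicator_iff[OF convex(1) nonempty(1) r_pos])
  moreover from this have "refl_prox f z - (?p - d) = t"
    using st by (simp add: refl_prox_def z_def scaleR_2 algebra_simps)
  then have "prox g (refl_prox f z) = ?p - d"
    using t by (simp add: prox_g_eq_iff subdifferential_indicator_fun nonempty)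
  ultimately show ?thesis by (intro that[of z]) simp
qed

lemma range_displacement: "range (\<lambda>z. prox f z - prox g (refl_prox f z)) = set_sub U V"
proof (intro equalityI subsetI)
  fix d assume "d \<in> set_sub U V"
  then obtain z where "prox f z - prox g (refl_prox f z) = d"
    by (rule displacement_attained)
  then show "d \<in> range (\<lambda>z. prox f z - prox g (refl_prox f z))" by blast
qed (use displacement_imp_normal_solution(1) in blast)

lemma minimizers_normal:
  assumes "d \<in> set_sub U V"
  shows "minimizers (\<lambda>y. ereal (- (y \<bullet> d)) + ereal (r / 2 * (norm (y - w))\<^sup>2)
      + indicator_fun U y + indicator_fun V (y - d)) = {normal_solution d}"
proof -
  let ?m = "w + (1 / r) *\<^sub>R d"
  \<comment> \<open>The constant left over from completing the square.\<close>
  define c where "c = - (w \<bullet> d) - (norm d)\<^sup>2 / (2 * r)"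
  have "- (y \<bullet> d) + r / 2 * (norm (y - w))\<^sup>2 = r / 2 * (dist ?m y)\<^sup>2 + c" for y
  proof -
    have "(dist ?m y)\<^sup>2 = (norm (y - w))\<^sup>2 - 2 / r * ((y - w) \<bullet> d) + (norm d)\<^sup>2 / r\<^sup>2"
    proof -
      have "?m - y = (1 / r) *\<^sub>R d - (y - w)" by simp
      then show ?thesis
        unfolding dist_norm power2_norm_eq_inner
        by (simp add: inner_diff_left inner_diff_right inner_commute power2_eq_square
            algebra_simps)
    qed
    then show ?thesis
      using r_pos by (simp add: c_def inner_simps field_simps power2_eq_square)
  qed
  then have "(\<lambda>y. ereal (- (y \<bullet> d)) + ereal (r / 2 * (norm (y - w))\<^sup>2)
      + indicator_fun U y + indicator_fun V (y - d))
      = (\<lambda>y. if y \<in> overlap d then ereal (r / 2 * (dist ?m y)\<^sup>2 + c) else \<infinity>)"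
    by (auto simp: indicator_fun_def overlap_def)
  then show ?thesis
    unfolding normal_solution_def
    using polyhedron_overlap[of d] overlap_nonempty[OF assms] r_pos
    by (simp add: minimizers_dist_sq polyhedron_imp_convex polyhedron_imp_closed)
qed

section \<open>The least displacement and convergence of the iterates\<close>

lemma convex_set_sub: "convex (set_sub U V)"
proof -
  have "set_sub U V = (\<Union>x\<in>U. \<Union>y\<in>V. {x - y})" by (auto simp: set_sub_def)
  then show ?thesis using convex_differences[OF convex] by simp
qed

lemmas closed_set_sub = closed_set_sub_polyhedron[OF polyhedron]

lemma set_sub_nonempty: "set_sub U V \<noteq> {}"
  using nonempty by (auto simp: set_sub_def)

lemma closest_point_set_sub_unique:
  assumes "d \<in> set_sub U V" "norm d \<le> norm (closest_point (set_sub U V) 0)"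
  shows "d = closest_point (set_sub U V) 0"
proof (rule closest_point_unique[OF convex_set_sub closed_set_sub assms(1)])
  show "\<forall>z\<in>set_sub U V. dist 0 d \<le> dist 0 z"
    using assms(2) closest_point_exists(2)[OF closed_set_sub set_sub_nonempty, of 0]
    by (auto intro: order.trans)
qed

text \<open>If \<open>v\<close> is nonzero then \<open>R\<close> has no fixed point, so the orbit of
  \<open>x\<close> is compared with a moving orbit on which \<open>prox f\<close> is
  constant.\<close>

lemma relaxed_convergence:
  fixes l :: real and x :: 'a
  assumes l: "0 < l" "l \<le> 1"
  defines "S \<equiv> \<lambda>y. (1 - l) *\<^sub>R y + l *\<^sub>R R y" and "v \<equiv> closest_point (set_sub U V) 0"
  shows "(\<lambda>n. prox f ((S ^^ n) x)) \<longlonglongrightarrow> normal_solution v"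
    and "l < 1 \<Longrightarrow> (\<lambda>n. prox g (refl_prox f ((S ^^ n) x))) \<longlonglongrightarrow> normal_solution v - v"
proof -
  have v: "v \<in> set_sub U V"
    unfolding v_def by (rule closest_point_in_set[OF closed_set_sub set_sub_nonempty])
  obtain y where "prox f y - prox g (refl_prox f y) = v"
    using displacement_attained[OF v] .
  then have y: "y - R y = 2 *\<^sub>R v" by (simp add: diff_R)
  \<comment> \<open>Displacements of \<open>R\<close> fill twice \<open>set_sub U V\<close>, where
    the element of least norm is unique.\<close>
  have least: "u - R u = 2 *\<^sub>R v" if "norm (u - R u) \<le> norm (2 *\<^sub>R v)" for u
    using that closest_point_set_sub_unique[folded v_def] range_displacement
    unfolding diff_R by auto
  have Sy: "(S ^^ n) y - R ((S ^^ n) y) = 2 *\<^sub>R v" for n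
    unfolding S_def
    using relaxed_iterates_displacement[of R "2 *\<^sub>R v" l y n] R_nonexpansive least l y by simp
  then have prox_Sy: "prox f ((S ^^ n) y) = normal_solution v" for n
    using displacement_imp_normal_solution(2)[of "(S ^^ n) y" v] by (simp add: diff_R)
  note lim = relaxed_iterates_tendsto[where R = R and P = "prox f" and c = "4 * r",
      OF R_contraction _ l, folded S_def, where x = x and y = y, unfolded Sy prox_Sy]
  show *: "(\<lambda>n. prox f ((S ^^ n) x)) \<longlonglongrightarrow> normal_solution v"
    using lim(1) r_pos by (simp add: LIM_zero_iff)
  assume "l < 1"
  then have "(\<lambda>n. (S ^^ n) x - R ((S ^^ n) x)) \<longlonglongrightarrow> 2 *\<^sub>R v"
    using lim(2) r_pos by (simp add: LIM_zero_iff)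
  \<comment> \<open>\<open>prox g (refl_prox f z)\<close> is \<open>prox f z\<close> minus half the
    displacement of \<open>R\<close> at \<open>z\<close>.\<close>
  from tendsto_diff[OF * tendsto_scaleR[OF tendsto_const[of "1/2"] this]]
  show "(\<lambda>n. prox g (refl_prox f ((S ^^ n) x))) \<longlonglongrightarrow> normal_solution v - v"
    by (simp add: diff_R)
qed

end

theorem proposition5p5:
  fixes w v x :: "'a::euclidean_space"
    and U V Z :: "'a set"
    and r :: real
    and f g :: "'a \<Rightarrow> ereal"
    and T :: "'a \<Rightarrow> 'a"
  assumes "polyhedron U" and "U \<noteq> {}"
    and "polyhedron V" and "V \<noteq> {}"
    and "r > 0"
    and "f = (\<lambda>y. ereal (r / 2 * (norm (y - w))\<^sup>2) + indicator_fun U y)"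
    and "g = indicator_fun V"
    and "T = (\<lambda>y. (1 / 2) *\<^sub>R (y + refl_prox g (refl_prox f y)))"
    and "v = closest_point (closure (range (\<lambda>y. y - T y))) 0"
    and "Z = {y. 0 \<in> {- v} + subdifferential f y + subdifferential g (y - v)}"
  shows "\<exists>xbar.
      strongly_convex f
    \<and> closure (range (\<lambda>y. y - T y)) = set_sub U V
    \<and> (v \<in> set_sub U V \<and> set_sub U V = set_sub (eff_domain f) (eff_domain g))
    \<and> (Z = minimizers (\<lambda>y. ereal (- (y \<bullet> v)) + ereal (r / 2 * (norm (y - w))\<^sup>2)
                            + indicator_fun U y + indicator_fun V (y - v))
       \<and> minimizers (\<lambda>y. ereal (- (y \<bullet> v)) + ereal (r / 2 * (norm (y - w))\<^sup>2)
                            + indicator_fun U y + indicator_fun V (y - v)) = {xbar})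
    \<and> v \<in> range (\<lambda>y. y - T y)
    \<and> prox f x = closest_point U ((1 / (r + 1)) *\<^sub>R x + (r / (r + 1)) *\<^sub>R w)
    \<and> prox g x = closest_point V x
    \<and> (\<forall>lam::real. 0 < lam \<and> lam \<le> 1 \<longrightarrow>
         (let T_lam = (\<lambda>y. (1 - lam) *\<^sub>R y + lam *\<^sub>R refl_prox g (refl_prox f y)) in
            ((\<lambda>n. prox f ((T_lam ^^ n) x)) \<longlonglongrightarrow> xbar)
          \<and> (lam < 1 \<longrightarrow> (\<lambda>n. prox g (refl_prox f ((T_lam ^^ n) x))) \<longlonglongrightarrow> xbar - v)))"
proof -
  interpret P: polyhedral_pair U V w r
    by unfold_locales (use assms in auto)
  have f: "f = quad_indicator r w U"
    unfolding quad_indicator_def assms(6) ..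
  have T: "y - T y = prox f y - prox g (refl_prox f y)" for y
  proof -
    have "y - T y = (1 / 2) *\<^sub>R (y - P.R y)"
      unfolding assms(8) P.R_def f assms(7)
      by (simp add: algebra_simps) (simp flip: scaleR_left.add)
    then show ?thesis unfolding P.diff_R f assms(7) by simp
  qed
  \<comment> \<open>The range is the whole difference set before any closure is taken, so
    \<open>v\<close> is itself a displacement.\<close>
  have range: "range (\<lambda>y. y - T y) = set_sub U V"
    unfolding T unfolding f assms(7) by (rule P.range_displacement)
  then have closure: "closure (range (\<lambda>y. y - T y)) = set_sub U V"
    by (simp add: P.closed_set_sub)
  have v_eq: "v = closest_point (set_sub U V) 0"
    unfolding assms(9) closure ..
  have v: "v \<in> set_sub U V"
    unfolding v_eq by (rule closest_point_in_set[OF P.closed_set_sub P.set_sub_nonempty])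
  have Z: "Z = {P.normal_solution v}"
    unfolding assms(10) f assms(7) by (rule P.normal_solutions[OF v])
  show ?thesis
    unfolding closure range Z P.minimizers_normal[OF v] Let_def
    unfolding f assms(7) eff_domain_quad_indicator
      eff_domain_indicator_fun P.prox_g[of x] P.prox_f[of w x]
    using strongly_convex_quad_indicator[OF P.convex(1) assms(2,5)] v
      P.relaxed_convergence[unfolded P.R_def, folded v_eq] P.closed_set_sub
    by (intro exI[of _ "P.normal_solution v"]) simp
qed

end
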